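(* Let $A$ be a complex algebra, $\tau\colon A\to A$ a non-zero map, and $B:=\tau(A)$. Let $\mathscr I_B$ denote the set of all involutions on $B$. Then the following statements are equivalent. (i) $\tau$ is a trivolution. (ii) $\tau$ is a conjugate-linear anti-homomorphism, and $\tau|_B\in\mathscr I_B$. (iii) $B$ is a subalgebra of $A$ and there exist a projection $p\colon A\to B$ (onto $B$) which is an algebra homomorphism, a two-sided ideal $I$ of $A$, and an involution $\rho$ on $B$ such that $A=I\oplus B$ and $\tau=\rho\circ p$. (iv) $B$ is a subalgebra of $A$, $\mathscr I_B$ is non-empty, and for each $\rho_2\in\mathscr I_B$ there is a surjective homomorphism $\rho_1\colon A\to B$ such that $\tau=\rho_2\circ\rho_1$ and $\rho_1\circ\rho_2\in\mathscr I_B$. Moreover, the statements (i)--(iv) remain equivalent if $A$ is a normed algebra and the maps occurring in (i)--(iv) are assumed to be contractive (so that, in particular, $\mathscr I_B$ denotes the set of contractive involutions on $B$).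
   Context: A map $\tau$ between algebras is an anti-homomorphism if it is multiplication-reversing: $\tau(xy)=\tau(y)\tau(x)$. An involution on a complex algebra $B$ is a conjugate-linear anti-homomorphism $\rho\colon B\to B$ with $\rho\circ\rho=\mathrm{id}_B$. A trivolution on a complex algebra $A$ is a non-zero conjugate-linear anti-homomorphism $\tau\colon A\to A$ such that $\tau^3=\tau$, where $\tau^3=\tau\circ\tau\circ\tau$; when $A$ is a normed algebra it is additionally assumed that $\|\tau\|=1$. A projection $p\colon A\to B$ onto a subalgebra $B$ is a linear map with range $B$ and $p\circ p=p$. The sum $A=I\oplus B$ is a direct sum of vector spaces. A map $f$ is contractive if $\|f(x)\|\le\|x\|$ for all $x$. *)

theory Defs
  imports "HOL-Analysis.Operator_Norm" "HOL-Library.FuncSet"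
begin

text \<open>
  Complex algebras are associative, and are required neither to be unital nor to be non-zero.
\<close>

class scaleC =
  fixes scaleC :: "complex \<Rightarrow> 'a \<Rightarrow> 'a"  (infixr "*\<^sub>C" 75)

class complex_vector = ab_group_add + scaleC +
  assumes scaleC_add_right: "a *\<^sub>C (x + y) = a *\<^sub>C x + a *\<^sub>C y"
    and scaleC_add_left: "(a + b) *\<^sub>C x = a *\<^sub>C x + b *\<^sub>C x"
    and scaleC_scaleC: "a *\<^sub>C b *\<^sub>C x = (a * b) *\<^sub>C x"
    and scaleC_one: "1 *\<^sub>C x = x"

class complex_algebra = complex_vector + ring +
  assumes mult_scaleC_left: "(a *\<^sub>C x) * y = a *\<^sub>C (x * y)"
    and mult_scaleC_right: "x * (a *\<^sub>C y) = a *\<^sub>C (x * y)"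

text \<open>
  Submultiplicativity of the norm and the compatibility with the additive structure are inherited
  from \<^class>\<open>real_normed_algebra\<close>; completeness is not required.
\<close>

class complex_normed_algebra = complex_algebra + real_normed_algebra +
  assumes scaleR_scaleC: "r *\<^sub>R x = complex_of_real r *\<^sub>C x"
    and norm_scaleC: "norm (a *\<^sub>C x) = cmod a * norm x"

interpretation complex_vector: vector_space "scaleC :: complex \<Rightarrow> 'a \<Rightarrow> 'a::complex_vector"
  by unfold_locales (simp_all add: scaleC_add_right scaleC_add_left scaleC_scaleC scaleC_one)

definition subalgebra :: "'a::complex_algebra set \<Rightarrow> bool" where
  "subalgebra B \<longleftrightarrow> complex_vector.subspace B \<and> (\<forall>x\<in>B. \<forall>y\<in>B. x * y \<in> B)"

definition two_sided_ideal :: "'a::complex_algebra set \<Rightarrow> bool" where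
  "two_sided_ideal I \<longleftrightarrow> complex_vector.subspace I \<and> (\<forall>a. \<forall>x\<in>I. a * x \<in> I \<and> x * a \<in> I)"

definition is_direct_sum :: "'a::complex_vector set \<Rightarrow> 'a set \<Rightarrow> bool" where
  "is_direct_sum I B \<longleftrightarrow> complex_vector.subspace I \<and> complex_vector.subspace B \<and>
     I \<inter> B = {0} \<and> {x + y | x y. x \<in> I \<and> y \<in> B} = UNIV"

definition algebra_hom :: "('a::complex_algebra \<Rightarrow> 'b::complex_algebra) \<Rightarrow> bool" where
  "algebra_hom f \<longleftrightarrow> Vector_Spaces.linear scaleC scaleC f \<and> (\<forall>x y. f (x * y) = f x * f y)"

definition projection_onto :: "'a::complex_vector set \<Rightarrow> ('a \<Rightarrow> 'a) \<Rightarrow> bool" where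
  "projection_onto B p \<longleftrightarrow> Vector_Spaces.linear scaleC scaleC p \<and> range p = B \<and> p \<circ> p = p"

text \<open>
  The next two notions are meant for a subalgebra \<open>S\<close>; then all the arguments below lie in \<open>S\<close>.
\<close>

definition conjugate_linear_on ::
    "'a::complex_vector set \<Rightarrow> ('a \<Rightarrow> 'b::complex_vector) \<Rightarrow> bool" where
  "conjugate_linear_on S f \<longleftrightarrow>
     (\<forall>x\<in>S. \<forall>y\<in>S. f (x + y) = f x + f y) \<and> (\<forall>c. \<forall>x\<in>S. f (c *\<^sub>C x) = cnj c *\<^sub>C f x)"

definition anti_homomorphism_on ::
    "'a::complex_algebra set \<Rightarrow> ('a \<Rightarrow> 'b::complex_algebra) \<Rightarrow> bool" where
  "anti_homomorphism_on S f \<longleftrightarrow> (\<forall>x\<in>S. \<forall>y\<in>S. f (x * y) = f y * f x)"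

text \<open>
  Maps \<open>B \<rightarrow> B\<close> are represented by extensional functions, so that this is the actual set of
  involutions on \<open>B\<close>, each represented once.
\<close>

definition involutions :: "'a::complex_algebra set \<Rightarrow> ('a \<Rightarrow> 'a) set" where
  "involutions B = {\<rho> \<in> B \<rightarrow>\<^sub>E B.
     conjugate_linear_on B \<rho> \<and> anti_homomorphism_on B \<rho> \<and> (\<forall>x\<in>B. \<rho> (\<rho> x) = x)}"

definition trivolution :: "('a::complex_algebra \<Rightarrow> 'a) \<Rightarrow> bool" where
  "trivolution \<tau> \<longleftrightarrow> \<tau> \<noteq> (\<lambda>_. 0) \<and> conjugate_linear_on UNIV \<tau> \<and>
     anti_homomorphism_on UNIV \<tau> \<and> \<tau> \<circ> \<tau> \<circ> \<tau> = \<tau>"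

text \<open>
  \<^const>\<open>onorm\<close> is a real supremum and is meaningful only for bounded maps, hence the explicit
  boundedness, in which the linearity is real linearity.
\<close>

definition normed_trivolution :: "('a::complex_normed_algebra \<Rightarrow> 'a) \<Rightarrow> bool" where
  "normed_trivolution \<tau> \<longleftrightarrow> trivolution \<tau> \<and> bounded_linear \<tau> \<and> onorm \<tau> = 1"

definition contractive_on :: "'a::real_normed_vector set \<Rightarrow> ('a \<Rightarrow> 'b::real_normed_vector) \<Rightarrow> bool"
  where "contractive_on S f \<longleftrightarrow> (\<forall>x\<in>S. norm (f x) \<le> norm x)"

definition contractive_involutions :: "'a::complex_normed_algebra set \<Rightarrow> ('a \<Rightarrow> 'a) set" where
  "contractive_involutions B = {\<rho> \<in> involutions B. contractive_on B \<rho>}"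

end

theory Submission
  imports Defs
begin

text \<open>
  Everything rests on \<open>\<tau>\<^sup>3 = \<tau>\<close> saying exactly that \<open>\<tau> \<circ> \<tau>\<close> is the identity on the range \<open>B\<close> of \<open>\<tau>\<close>.
  For a conjugate-linear anti-homomorphism \<open>\<tau>\<close> this says that \<open>\<tau>\<close> restricts to an involution of
  \<open>B\<close>, and also that \<open>p = \<tau> \<circ> \<tau>\<close>, in which the two conjugations and the two reversals
  cancel, is a homomorphic projection onto \<open>B\<close>. Its kernel is that of \<open>\<tau>\<close>, a two-sided ideal
  complementing \<open>B\<close>, and \<open>\<tau> = \<tau>|\<^sub>B \<circ> p\<close> (\<open>trivolution_decomposition\<close>). Conversely, if
  \<open>\<tau> = \<rho> \<circ> p\<close> with \<open>p\<close> a projection onto \<open>B\<close>, then \<open>\<tau>\<close> agrees on \<open>B\<close> with the involution \<open>\<rho>\<close>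
  (\<open>involution_comp_projection\<close>).

  An arbitrary involution \<open>\<rho>\<^sub>2\<close> of \<open>B\<close> can be split off instead of \<open>\<tau>|\<^sub>B\<close>: since \<open>\<rho>\<^sub>2\<close> is its own
  inverse, the only factor \<open>\<rho>\<^sub>1\<close> with values in \<open>B\<close> and \<open>\<tau> = \<rho>\<^sub>2 \<circ> \<rho>\<^sub>1\<close> is
  \<open>\<rho>\<^sub>2 \<circ> \<tau>\<close>, and \<open>\<rho>\<^sub>1 \<circ> \<rho>\<^sub>2\<close> is then the conjugate \<open>\<rho>\<^sub>2 \<circ> \<tau>|\<^sub>B \<circ> \<rho>\<^sub>2\<close> of an involution
  (\<open>trivolution_factor\<close>, \<open>trivolution_of_factor\<close>).

  All the maps produced are compositions of the given ones, so contractivity is inherited. The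
  norm condition adds nothing more: a contractive \<open>\<tau>\<close> that is its own inverse on \<open>B \<noteq> {0}\<close> is
  isometric there, so its norm, being at most \<open>1\<close>, equals \<open>1\<close> (\<open>normed_trivolution_iff\<close>).
\<close>

section \<open>Conjugate-linear anti-homomorphisms\<close>

lemma linear_scaleC_iff:
  fixes f :: "'a::complex_vector \<Rightarrow> 'b::complex_vector"
  shows "Vector_Spaces.linear scaleC scaleC f \<longleftrightarrow>
    (\<forall>x y. f (x + y) = f x + f y) \<and> (\<forall>c x. f (c *\<^sub>C x) = c *\<^sub>C f x)"
  by (simp add: linear_iff_module_hom module_hom_iff complex_vector.module_axioms)

lemma algebra_hom_iff:
  "algebra_hom f \<longleftrightarrow> (\<forall>x y. f (x + y) = f x + f y) \<and>
    (\<forall>c x. f (c *\<^sub>C x) = c *\<^sub>C f x) \<and> (\<forall>x y. f (x * y) = f x * f y)"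
  unfolding algebra_hom_def linear_scaleC_iff by blast

definition conj_antihom_on ::
    "'a::complex_algebra set \<Rightarrow> ('a \<Rightarrow> 'b::complex_algebra) \<Rightarrow> bool" where
  "conj_antihom_on S f \<longleftrightarrow> conjugate_linear_on S f \<and> anti_homomorphism_on S f"

lemma conj_antihom_onD:
  assumes "conj_antihom_on S f" "x \<in> S"
  shows conj_antihom_on_add: "y \<in> S \<Longrightarrow> f (x + y) = f x + f y"
    and conj_antihom_on_scale: "f (c *\<^sub>C x) = cnj c *\<^sub>C f x"
    and conj_antihom_on_mult: "y \<in> S \<Longrightarrow> f (x * y) = f y * f x"
  using assms
  unfolding conj_antihom_on_def conjugate_linear_on_def anti_homomorphism_on_def by blast+

lemma conj_antihom_onI:
  assumes "\<And>x y. x \<in> S \<Longrightarrow> y \<in> S \<Longrightarrow> f (x + y) = f x + f y"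
    and "\<And>c x. x \<in> S \<Longrightarrow> f (c *\<^sub>C x) = cnj c *\<^sub>C f x"
    and "\<And>x y. x \<in> S \<Longrightarrow> y \<in> S \<Longrightarrow> f (x * y) = f y * f x"
  shows "conj_antihom_on S f"
  using assms
  unfolding conj_antihom_on_def conjugate_linear_on_def anti_homomorphism_on_def by blast

lemma conj_antihom_zero:
  assumes "conj_antihom_on UNIV f"
  shows "f 0 = 0"
  using conj_antihom_on_scale[OF assms, of 0 0] by simp

lemma conj_antihom_diff:
  assumes "conj_antihom_on UNIV f"
  shows "f (x - y) = f x - f y"
  using conj_antihom_on_add[OF assms, of "x - y" y] by (simp add: eq_diff_eq)

lemma subalgebra_range:
  assumes "conj_antihom_on UNIV f"
  shows "subalgebra (range f)"
  unfolding subalgebra_def complex_vector.subspace_def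
proof (intro conjI ballI allI)
  show "0 \<in> range f"
    using conj_antihom_zero[OF assms] by (metis rangeI)
next
  fix u v assume "u \<in> range f" "v \<in> range f"
  then obtain x y where uv: "u = f x" "v = f y" by blast
  show "u + v \<in> range f"
    using conj_antihom_on_add[OF assms, of x y] uv by (metis UNIV_I rangeI)
  show "u * v \<in> range f"
    using conj_antihom_on_mult[OF assms, of y x] uv by (metis UNIV_I rangeI)
next
  fix c u assume "u \<in> range f"
  then obtain x where u: "u = f x" by blast
  show "c *\<^sub>C u \<in> range f"
    using conj_antihom_on_scale[OF assms, of x "cnj c"] u by (metis UNIV_I rangeI complex_cnj_cnj)
qed

lemma two_sided_ideal_kernel:
  assumes "conj_antihom_on UNIV f"
  shows "two_sided_ideal {x. f x = 0}"
  using conj_antihom_zero[OF assms] conj_antihom_onD[OF assms]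
  unfolding two_sided_ideal_def complex_vector.subspace_def by simp

lemma algebra_hom_comp_conj_antihom:
  assumes f: "conj_antihom_on UNIV f" and g: "conj_antihom_on S g" and S: "range f \<subseteq> S"
  shows "algebra_hom (g \<circ> f)"
proof -
  have "f x \<in> S" for x
    using S by blast
  then show ?thesis
    unfolding algebra_hom_iff
    by (simp add: conj_antihom_onD[OF f] conj_antihom_onD[OF g])
qed

lemma conj_antihom_comp_algebra_hom:
  assumes f: "algebra_hom f" and g: "conj_antihom_on S g" and S: "range f \<subseteq> S"
  shows "conj_antihom_on UNIV (g \<circ> f)"
proof -
  have "f x \<in> S" for x
    using S by blast
  then show ?thesis
    using f unfolding algebra_hom_iff
    by (intro conj_antihom_onI) (simp_all add: conj_antihom_onD[OF g])
qed

section \<open>Involutions and trivolutions\<close>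

lemma involutions_iff:
  "\<rho> \<in> involutions B \<longleftrightarrow>
    \<rho> \<in> B \<rightarrow>\<^sub>E B \<and> conj_antihom_on B \<rho> \<and> (\<forall>x\<in>B. \<rho> (\<rho> x) = x)"
  unfolding involutions_def conj_antihom_on_def by blast

lemma involutionsD:
  assumes "\<rho> \<in> involutions B"
  shows involution_extensional: "\<rho> \<in> extensional B"
    and involution_closed: "x \<in> B \<Longrightarrow> \<rho> x \<in> B"
    and involution_conj_antihom: "conj_antihom_on B \<rho>"
    and involution_twice: "x \<in> B \<Longrightarrow> \<rho> (\<rho> x) = x"
  using assms unfolding involutions_iff by (auto simp: PiE_iff)

text \<open>
  Closure of \<open>B\<close> under the operations is what allows \<open>f\<close> to be replaced by its restriction in the
  conjugate-linearity and anti-multiplicativity laws.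
\<close>

lemma restrict_in_involutions:
  assumes B: "subalgebra B" and f: "conj_antihom_on B f"
    and closed: "\<And>x. x \<in> B \<Longrightarrow> f x \<in> B" and twice: "\<And>x. x \<in> B \<Longrightarrow> f (f x) = x"
  shows "restrict f B \<in> involutions B"
  unfolding involutions_iff
proof (intro conjI ballI)
  show "restrict f B \<in> B \<rightarrow>\<^sub>E B"
    using closed by simp
  show "conj_antihom_on B (restrict f B)"
    using B unfolding subalgebra_def complex_vector.subspace_def
    by (intro conj_antihom_onI) (simp_all add: conj_antihom_onD[OF f])
  show "restrict f B (restrict f B x) = x" if "x \<in> B" for x
    using that closed twice by simp
qed

lemma trivolution_iff:
  assumes "\<tau> \<noteq> (\<lambda>_. 0)"
  shows "trivolution \<tau> \<longleftrightarrow> conj_antihom_on UNIV \<tau> \<and> (\<forall>b\<in>range \<tau>. \<tau> (\<tau> b) = b)"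
  using assms unfolding trivolution_def conj_antihom_on_def fun_eq_iff by auto

lemma trivolutionD:
  assumes "trivolution \<tau>"
  shows trivolution_nonzero: "\<tau> \<noteq> (\<lambda>_. 0)"
    and trivolution_conj_antihom: "conj_antihom_on UNIV \<tau>"
    and trivolution_thrice: "\<tau> (\<tau> (\<tau> x)) = \<tau> x"
  using assms unfolding trivolution_def conj_antihom_on_def fun_eq_iff by simp_all

lemma trivolution_restrict:
  assumes "trivolution \<tau>"
  shows "restrict \<tau> (range \<tau>) \<in> involutions (range \<tau>)"
proof (rule restrict_in_involutions)
  note \<tau> = trivolution_conj_antihom[OF assms]
  show "subalgebra (range \<tau>)"
    by (rule subalgebra_range[OF \<tau>])
  show "conj_antihom_on (range \<tau>) \<tau>"
    by (intro conj_antihom_onI) (simp_all add: conj_antihom_onD[OF \<tau>])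
qed (use trivolution_thrice[OF assms] in auto)

lemma trivolution_iff_restrict:
  assumes "\<tau> \<noteq> (\<lambda>_. 0)"
  shows "trivolution \<tau> \<longleftrightarrow>
    conj_antihom_on UNIV \<tau> \<and> restrict \<tau> (range \<tau>) \<in> involutions (range \<tau>)"
proof
  assume "trivolution \<tau>"
  then show "conj_antihom_on UNIV \<tau> \<and> restrict \<tau> (range \<tau>) \<in> involutions (range \<tau>)"
    using trivolution_conj_antihom trivolution_restrict by blast
next
  assume r: "conj_antihom_on UNIV \<tau> \<and> restrict \<tau> (range \<tau>) \<in> involutions (range \<tau>)"
  then have "\<forall>b\<in>range \<tau>. \<tau> (\<tau> b) = b"
    using involution_twice[of "restrict \<tau> (range \<tau>)" "range \<tau>"] by auto
  with r show "trivolution \<tau>"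
    using trivolution_iff[OF assms] by blast
qed

section \<open>The decomposition through a homomorphic projection\<close>

lemma trivolution_decomposition:
  assumes "trivolution \<tau>"
  defines "B \<equiv> range \<tau>"
  shows "projection_onto B (\<tau> \<circ> \<tau>)" and "algebra_hom (\<tau> \<circ> \<tau>)"
    and "is_direct_sum {x. \<tau> x = 0} B" and "\<tau> = restrict \<tau> B \<circ> (\<tau> \<circ> \<tau>)"
proof -
  note \<tau> = trivolution_conj_antihom[OF assms(1)] and thrice = trivolution_thrice[OF assms(1)]
  show hom: "algebra_hom (\<tau> \<circ> \<tau>)"
    by (rule algebra_hom_comp_conj_antihom[OF \<tau> \<tau>]) simp
  have "range (\<tau> \<circ> \<tau>) = B"
  proof
    show "range (\<tau> \<circ> \<tau>) \<subseteq> B"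
      unfolding B_def by auto
    show "B \<subseteq> range (\<tau> \<circ> \<tau>)"
      unfolding B_def using thrice by (metis (no_types, lifting) comp_apply image_subsetI rangeI)
  qed
  moreover have "(\<tau> \<circ> \<tau>) \<circ> (\<tau> \<circ> \<tau>) = \<tau> \<circ> \<tau>"
    using thrice by (simp add: fun_eq_iff)
  ultimately show "projection_onto B (\<tau> \<circ> \<tau>)"
    using hom unfolding projection_onto_def algebra_hom_def by blast
  show "\<tau> = restrict \<tau> B \<circ> (\<tau> \<circ> \<tau>)"
    unfolding B_def using thrice by (simp add: fun_eq_iff)
  show "is_direct_sum {x. \<tau> x = 0} B"
    unfolding is_direct_sum_def
  proof (intro conjI)
    show "complex_vector.subspace {x. \<tau> x = 0}"
      using two_sided_ideal_kernel[OF \<tau>] unfolding two_sided_ideal_def by blast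
    show "complex_vector.subspace B"
      using subalgebra_range[OF \<tau>] unfolding B_def subalgebra_def by blast
    show "{x. \<tau> x = 0} \<inter> B = {0}"
    proof (intro equalityI subsetI)
      \<comment> \<open>On \<open>B\<close> a vector killed by \<open>\<tau>\<close> is \<open>b = \<tau> (\<tau> b) = \<tau> 0 = 0\<close>.\<close>
      show "b \<in> {0}" if "b \<in> {x. \<tau> x = 0} \<inter> B" for b
        using that thrice conj_antihom_zero[OF \<tau>] unfolding B_def
        by (metis (mono_tags, lifting) IntE imageE mem_Collect_eq singletonI)
      show "b \<in> {x. \<tau> x = 0} \<inter> B" if "b \<in> {0}" for b
        using that conj_antihom_zero[OF \<tau>] unfolding B_def by (auto intro: image_eqI[of _ _ 0])
    qed
    have "\<tau> (x - \<tau> (\<tau> x)) = 0" for x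
      using thrice by (simp add: conj_antihom_diff[OF \<tau>])
    moreover have "x = (x - \<tau> (\<tau> x)) + \<tau> (\<tau> x)" for x
      by simp
    ultimately show "{x + y |x y. x \<in> {x. \<tau> x = 0} \<and> y \<in> B} = UNIV"
      unfolding B_def by blast
  qed
qed

lemma involution_comp_projection:
  assumes p: "projection_onto B p" "algebra_hom p" and \<rho>: "\<rho> \<in> involutions B"
  shows "conj_antihom_on UNIV (\<rho> \<circ> p)" and "restrict (\<rho> \<circ> p) B = \<rho>"
proof -
  have "range p = B" and idem: "p (p x) = p x" for x
    using p(1) unfolding projection_onto_def fun_eq_iff by simp_all
  then have on_B: "p b = b" if "b \<in> B" for b
    using that by auto
  show "conj_antihom_on UNIV (\<rho> \<circ> p)"
    using \<open>range p = B\<close>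
    by (intro conj_antihom_comp_algebra_hom[OF p(2) involution_conj_antihom[OF \<rho>]]) simp
  show "restrict (\<rho> \<circ> p) B = \<rho>"
    by (rule extensionalityI[OF restrict_extensional involution_extensional[OF \<rho>]])
      (simp add: on_B)
qed

section \<open>Splitting off a prescribed involution\<close>

lemma trivolution_factor:
  assumes "trivolution \<tau>" and \<rho>: "\<rho> \<in> involutions B" and B: "B = range \<tau>"
  shows "algebra_hom (\<rho> \<circ> \<tau>)" and "range (\<rho> \<circ> \<tau>) = B" and "\<tau> = \<rho> \<circ> (\<rho> \<circ> \<tau>)"
    and "compose B (\<rho> \<circ> \<tau>) \<rho> \<in> involutions B"
proof -
  note \<tau> = trivolution_conj_antihom[OF assms(1)]
  note closed = involution_closed[OF \<rho>] and twice = involution_twice[OF \<rho>]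
  have \<tau>_B: "\<tau> x \<in> B" for x
    using B by blast
  have \<tau>_twice: "\<tau> (\<tau> b) = b" if "b \<in> B" for b
    using that trivolution_thrice[OF assms(1)] B by auto
  show hom: "algebra_hom (\<rho> \<circ> \<tau>)"
    by (rule algebra_hom_comp_conj_antihom[OF \<tau> involution_conj_antihom[OF \<rho>]]) (simp add: B)
  show "\<tau> = \<rho> \<circ> (\<rho> \<circ> \<tau>)"
    using twice \<tau>_B by (simp add: fun_eq_iff)
  have "\<rho> ` B = B"
    using closed twice by (metis image_subsetI subsetI subset_antisym image_eqI)
  then show "range (\<rho> \<circ> \<tau>) = B"
    using B by (metis image_comp)
  have "restrict (\<rho> \<circ> \<tau> \<circ> \<rho>) B \<in> involutions B"
  proof (rule restrict_in_involutions)
    show "subalgebra B"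
      using subalgebra_range[OF \<tau>] B by simp
    show "conj_antihom_on B (\<rho> \<circ> \<tau> \<circ> \<rho>)"
      using hom unfolding algebra_hom_iff
      by (intro conj_antihom_onI)
        (simp_all add: conj_antihom_onD[OF involution_conj_antihom[OF \<rho>]])
  qed (simp_all add: closed twice \<tau>_B \<tau>_twice)
  then show "compose B (\<rho> \<circ> \<tau>) \<rho> \<in> involutions B"
    by (simp add: compose_def comp_def)
qed

text \<open>
  On \<open>B\<close>, the identity \<open>\<rho>\<^sub>2 \<rho>\<^sub>1 \<rho>\<^sub>2 \<rho>\<^sub>1 = id\<close> is the conjugate by \<open>\<rho>\<^sub>2\<close> of the identity
  \<open>\<rho>\<^sub>1 \<rho>\<^sub>2 \<rho>\<^sub>1 \<rho>\<^sub>2 = id\<close> expressed by the last hypothesis.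
\<close>

lemma trivolution_of_factor:
  assumes nz: "\<rho>\<^sub>2 \<circ> \<rho>\<^sub>1 \<noteq> (\<lambda>_. 0)" and B: "range (\<rho>\<^sub>2 \<circ> \<rho>\<^sub>1) = B"
    and \<rho>\<^sub>2: "\<rho>\<^sub>2 \<in> involutions B" and \<rho>\<^sub>1: "algebra_hom \<rho>\<^sub>1" "range \<rho>\<^sub>1 = B"
    and inv: "compose B \<rho>\<^sub>1 \<rho>\<^sub>2 \<in> involutions B"
  shows "trivolution (\<rho>\<^sub>2 \<circ> \<rho>\<^sub>1)"
proof -
  note closed = involution_closed[OF \<rho>\<^sub>2] and twice = involution_twice[OF \<rho>\<^sub>2]
  have \<rho>\<^sub>1_B: "\<rho>\<^sub>1 x \<in> B" for x
    using \<rho>\<^sub>1(2) by blast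
  have "\<rho>\<^sub>1 (\<rho>\<^sub>2 (\<rho>\<^sub>1 (\<rho>\<^sub>2 b))) = b" if "b \<in> B" for b
    using involution_twice[OF inv that] that \<rho>\<^sub>1_B by (simp add: compose_eq)
  then have "\<rho>\<^sub>2 (\<rho>\<^sub>1 (\<rho>\<^sub>2 (\<rho>\<^sub>1 b))) = b" if "b \<in> B" for b
    using that closed twice by metis
  moreover have "conj_antihom_on UNIV (\<rho>\<^sub>2 \<circ> \<rho>\<^sub>1)"
    using \<rho>\<^sub>1
    by (intro conj_antihom_comp_algebra_hom[OF \<rho>\<^sub>1(1) involution_conj_antihom[OF \<rho>\<^sub>2]]) simp
  ultimately show ?thesis
    unfolding trivolution_iff[OF nz] B by simp
qed

section \<open>Contractivity and the norm of a trivolution\<close>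

lemma contractive_on_comp:
  assumes "contractive_on S f" "contractive_on T g" "f ` S \<subseteq> T"
  shows "contractive_on S (g \<circ> f)"
  unfolding contractive_on_def comp_apply
proof
  fix x assume "x \<in> S"
  then have "norm (g (f x)) \<le> norm (f x)"
    using assms(2,3) unfolding contractive_on_def by blast
  also have "\<dots> \<le> norm x"
    using assms(1) \<open>x \<in> S\<close> unfolding contractive_on_def by blast
  finally show "norm (g (f x)) \<le> norm x" .
qed

lemma contractive_on_mono:
  assumes "contractive_on T f" "S \<subseteq> T"
  shows "contractive_on S f"
  using assms unfolding contractive_on_def by blast

lemma contractive_on_restrict [simp]: "contractive_on S (restrict f S) \<longleftrightarrow> contractive_on S f"
  unfolding contractive_on_def by simp

lemma contractive_on_compose [simp]: "contractive_on S (compose S g f) \<longleftrightarrow> contractive_on S (g \<circ> f)"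
  unfolding contractive_on_def by (simp add: compose_eq)

lemma conj_antihom_contractive_bounded_linear:
  fixes f :: "'a::complex_normed_algebra \<Rightarrow> 'b::complex_normed_algebra"
  assumes f: "conj_antihom_on UNIV f" and "contractive_on UNIV f"
  shows "bounded_linear f"
proof (rule bounded_linear_intro[where K = 1])
  show "f (r *\<^sub>R x) = r *\<^sub>R f x" for r x
    using conj_antihom_on_scale[OF f, of x "complex_of_real r"] by (simp add: scaleR_scaleC)
qed (use assms conj_antihom_on_add[OF f] in \<open>simp_all add: contractive_on_def\<close>)

lemma normed_trivolution_iff:
  "normed_trivolution \<tau> \<longleftrightarrow> trivolution \<tau> \<and> contractive_on UNIV \<tau>"
proof
  assume "normed_trivolution \<tau>"
  then have "trivolution \<tau>" "bounded_linear \<tau>" "onorm \<tau> = 1"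
    unfolding normed_trivolution_def by simp_all
  then show "trivolution \<tau> \<and> contractive_on UNIV \<tau>"
    using onorm[of \<tau>] unfolding contractive_on_def by simp
next
  assume r: "trivolution \<tau> \<and> contractive_on UNIV \<tau>"
  then have contr: "norm (\<tau> x) \<le> norm x" for x
    unfolding contractive_on_def by simp
  have bl: "bounded_linear \<tau>"
    using r trivolution_conj_antihom conj_antihom_contractive_bounded_linear by blast
  obtain x where x: "\<tau> x \<noteq> 0"
    using r trivolution_nonzero by blast
  \<comment> \<open>At \<open>b = \<tau> x\<close> the bound \<open>\<parallel>\<tau> b\<parallel> \<le> \<parallel>b\<parallel>\<close> is attained, since \<open>b = \<tau> (\<tau> b)\<close>.\<close>
  have "norm (\<tau> x) = norm (\<tau> (\<tau> (\<tau> x)))"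
    using r trivolution_thrice by metis
  also have "\<dots> \<le> norm (\<tau> (\<tau> x))"
    by (rule contr)
  also have "\<dots> \<le> onorm \<tau> * norm (\<tau> x)"
    by (rule onorm[OF bl])
  finally have "1 \<le> onorm \<tau>"
    using x by simp
  moreover have "onorm \<tau> \<le> 1"
    by (rule onorm_bound) (simp_all add: contr)
  ultimately show "normed_trivolution \<tau>"
    using r bl unfolding normed_trivolution_def by simp
qed

section \<open>The equivalences\<close>

theorem theorem2p3:
  fixes \<tau> :: "'a::complex_algebra \<Rightarrow> 'a"
    and \<sigma> :: "'b::complex_normed_algebra \<Rightarrow> 'b"
  shows
   "(\<tau> \<noteq> (\<lambda>_. 0) \<longrightarrow>
      (let B = range \<tau> in
        (trivolution \<tau> \<longleftrightarrow>
          conjugate_linear_on UNIV \<tau> \<and> anti_homomorphism_on UNIV \<tau> \<and>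
          restrict \<tau> B \<in> involutions B) \<and>
        (trivolution \<tau> \<longleftrightarrow>
          subalgebra B \<and>
          (\<exists>p I \<rho>. projection_onto B p \<and> algebra_hom p \<and> two_sided_ideal I \<and>
             \<rho> \<in> involutions B \<and> is_direct_sum I B \<and> \<tau> = \<rho> \<circ> p)) \<and>
        (trivolution \<tau> \<longleftrightarrow>
          subalgebra B \<and> involutions B \<noteq> {} \<and>
          (\<forall>\<rho>\<^sub>2\<in>involutions B. \<exists>\<rho>\<^sub>1. algebra_hom \<rho>\<^sub>1 \<and> range \<rho>\<^sub>1 = B \<and>
             \<tau> = \<rho>\<^sub>2 \<circ> \<rho>\<^sub>1 \<and> compose B \<rho>\<^sub>1 \<rho>\<^sub>2 \<in> involutions B))))
    \<and>
    (\<sigma> \<noteq> (\<lambda>_. 0) \<longrightarrow>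
      (let B = range \<sigma> in
        (normed_trivolution \<sigma> \<longleftrightarrow>
          conjugate_linear_on UNIV \<sigma> \<and> anti_homomorphism_on UNIV \<sigma> \<and>
          contractive_on UNIV \<sigma> \<and>
          restrict \<sigma> B \<in> contractive_involutions B) \<and>
        (normed_trivolution \<sigma> \<longleftrightarrow>
          subalgebra B \<and>
          (\<exists>p I \<rho>. projection_onto B p \<and> algebra_hom p \<and> contractive_on UNIV p \<and>
             two_sided_ideal I \<and>
             \<rho> \<in> contractive_involutions B \<and> is_direct_sum I B \<and> \<sigma> = \<rho> \<circ> p)) \<and>
        (normed_trivolution \<sigma> \<longleftrightarrow>
          subalgebra B \<and> contractive_involutions B \<noteq> {} \<and>
          (\<forall>\<rho>\<^sub>2\<in>contractive_involutions B. \<exists>\<rho>\<^sub>1. algebra_hom \<rho>\<^sub>1 \<and> range \<rho>\<^sub>1 = B \<and>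
             contractive_on UNIV \<rho>\<^sub>1 \<and>
             \<sigma> = \<rho>\<^sub>2 \<circ> \<rho>\<^sub>1 \<and> compose B \<rho>\<^sub>1 \<rho>\<^sub>2 \<in> contractive_involutions B))))"
proof (intro conjI impI)
  assume nz: "\<tau> \<noteq> (\<lambda>_. 0)"
  define B where "B = range \<tau>"
  have i_ii: "trivolution \<tau> \<longleftrightarrow>
      conjugate_linear_on UNIV \<tau> \<and> anti_homomorphism_on UNIV \<tau> \<and> restrict \<tau> B \<in> involutions B"
    using trivolution_iff_restrict[OF nz] unfolding B_def conj_antihom_on_def by blast
  have i_iii: "trivolution \<tau> \<longleftrightarrow>
      subalgebra B \<and>
      (\<exists>p I \<rho>. projection_onto B p \<and> algebra_hom p \<and> two_sided_ideal I \<and>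
         \<rho> \<in> involutions B \<and> is_direct_sum I B \<and> \<tau> = \<rho> \<circ> p)"
    (is "_ \<longleftrightarrow> ?iii")
  proof
    assume "trivolution \<tau>"
    then show ?iii
      unfolding B_def
      using trivolution_decomposition[of \<tau>] trivolution_restrict[of \<tau>] trivolution_conj_antihom
        subalgebra_range[of \<tau>] two_sided_ideal_kernel[of \<tau>] by blast
  next
    assume ?iii
    then obtain p \<rho> where "projection_onto B p" "algebra_hom p" and \<rho>: "\<rho> \<in> involutions B"
      and "\<tau> = \<rho> \<circ> p"
      by blast
    then have "conj_antihom_on UNIV \<tau>" "restrict \<tau> B = \<rho>"
      using involution_comp_projection by blast+
    with \<rho> show "trivolution \<tau>"
      using trivolution_iff_restrict[OF nz] unfolding B_def by simp
  qed
  have i_iv: "trivolution \<tau> \<longleftrightarrow>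
      subalgebra B \<and> involutions B \<noteq> {} \<and>
      (\<forall>\<rho>\<^sub>2\<in>involutions B. \<exists>\<rho>\<^sub>1. algebra_hom \<rho>\<^sub>1 \<and> range \<rho>\<^sub>1 = B \<and>
         \<tau> = \<rho>\<^sub>2 \<circ> \<rho>\<^sub>1 \<and> compose B \<rho>\<^sub>1 \<rho>\<^sub>2 \<in> involutions B)"
    (is "_ \<longleftrightarrow> ?iv")
  proof
    assume triv: "trivolution \<tau>"
    have "subalgebra B" "involutions B \<noteq> {}"
      using subalgebra_range[OF trivolution_conj_antihom] trivolution_restrict triv
      unfolding B_def by blast+
    then show ?iv
      using trivolution_factor[OF triv _ B_def] by blast
  next
    assume ?iv
    then obtain \<rho>\<^sub>2 \<rho>\<^sub>1 where "\<rho>\<^sub>2 \<in> involutions B" "algebra_hom \<rho>\<^sub>1" "range \<rho>\<^sub>1 = B"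
      "\<tau> = \<rho>\<^sub>2 \<circ> \<rho>\<^sub>1" "compose B \<rho>\<^sub>1 \<rho>\<^sub>2 \<in> involutions B"
      by blast
    then show "trivolution \<tau>"
      using trivolution_of_factor[of \<rho>\<^sub>2 \<rho>\<^sub>1 B] nz unfolding B_def by simp
  qed
  show "let B = range \<tau> in
        (trivolution \<tau> \<longleftrightarrow>
          conjugate_linear_on UNIV \<tau> \<and> anti_homomorphism_on UNIV \<tau> \<and>
          restrict \<tau> B \<in> involutions B) \<and>
        (trivolution \<tau> \<longleftrightarrow>
          subalgebra B \<and>
          (\<exists>p I \<rho>. projection_onto B p \<and> algebra_hom p \<and> two_sided_ideal I \<and>
             \<rho> \<in> involutions B \<and> is_direct_sum I B \<and> \<tau> = \<rho> \<circ> p)) \<and>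
        (trivolution \<tau> \<longleftrightarrow>
          subalgebra B \<and> involutions B \<noteq> {} \<and>
          (\<forall>\<rho>\<^sub>2\<in>involutions B. \<exists>\<rho>\<^sub>1. algebra_hom \<rho>\<^sub>1 \<and> range \<rho>\<^sub>1 = B \<and>
             \<tau> = \<rho>\<^sub>2 \<circ> \<rho>\<^sub>1 \<and> compose B \<rho>\<^sub>1 \<rho>\<^sub>2 \<in> involutions B))"
    unfolding Let_def B_def[symmetric] by (intro conjI i_ii i_iii i_iv)
next
  assume nz: "\<sigma> \<noteq> (\<lambda>_. 0)"
  define B where "B = range \<sigma>"
  have contr_inv: "\<rho> \<in> contractive_involutions B \<longleftrightarrow> \<rho> \<in> involutions B \<and> contractive_on B \<rho>" for \<rho>
    unfolding contractive_involutions_def by simp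
  have restr: "restrict \<sigma> B \<in> contractive_involutions B" if "normed_trivolution \<sigma>"
    using that trivolution_restrict[of \<sigma>, folded B_def] contractive_on_mono[of UNIV \<sigma> B]
    unfolding contr_inv normed_trivolution_iff by simp
  have i_ii: "normed_trivolution \<sigma> \<longleftrightarrow>
      conjugate_linear_on UNIV \<sigma> \<and> anti_homomorphism_on UNIV \<sigma> \<and> contractive_on UNIV \<sigma> \<and>
      restrict \<sigma> B \<in> contractive_involutions B"
    using trivolution_iff_restrict[OF nz, folded B_def] restr
    unfolding normed_trivolution_iff conj_antihom_on_def contr_inv by blast
  have i_iii: "normed_trivolution \<sigma> \<longleftrightarrow>
      subalgebra B \<and>
      (\<exists>p I \<rho>. projection_onto B p \<and> algebra_hom p \<and> contractive_on UNIV p \<and>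
         two_sided_ideal I \<and>
         \<rho> \<in> contractive_involutions B \<and> is_direct_sum I B \<and> \<sigma> = \<rho> \<circ> p)"
    (is "_ \<longleftrightarrow> ?iii")
  proof
    assume r: "normed_trivolution \<sigma>"
    then have triv: "trivolution \<sigma>" and "contractive_on UNIV \<sigma>"
      unfolding normed_trivolution_iff by simp_all
    then have "contractive_on UNIV (\<sigma> \<circ> \<sigma>)"
      using contractive_on_comp by blast
    moreover have "subalgebra B" "two_sided_ideal {x. \<sigma> x = 0}"
      using subalgebra_range two_sided_ideal_kernel trivolution_conj_antihom[OF triv]
      unfolding B_def by blast+
    ultimately show ?iii
      using trivolution_decomposition[OF triv] restr[OF r] unfolding B_def by blast
  next
    assume ?iii
    then obtain p \<rho> where p: "projection_onto B p" "algebra_hom p" "contractive_on UNIV p"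
      and \<rho>: "\<rho> \<in> involutions B" "contractive_on B \<rho>" and \<sigma>: "\<sigma> = \<rho> \<circ> p"
      unfolding contr_inv by blast
    have "conj_antihom_on UNIV \<sigma>" "restrict \<sigma> B = \<rho>"
      using involution_comp_projection[OF p(1,2) \<rho>(1)] \<sigma> by simp_all
    then have "trivolution \<sigma>"
      using trivolution_iff_restrict[OF nz] \<rho>(1) unfolding B_def by simp
    moreover have "contractive_on UNIV \<sigma>"
      using p(1) contractive_on_comp[OF p(3) \<rho>(2)] \<sigma> unfolding projection_onto_def by simp
    ultimately show "normed_trivolution \<sigma>"
      unfolding normed_trivolution_iff by simp
  qed
  have i_iv: "normed_trivolution \<sigma> \<longleftrightarrow>
      subalgebra B \<and> contractive_involutions B \<noteq> {} \<and>
      (\<forall>\<rho>\<^sub>2\<in>contractive_involutions B. \<exists>\<rho>\<^sub>1. algebra_hom \<rho>\<^sub>1 \<and> range \<rho>\<^sub>1 = B \<and>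
         contractive_on UNIV \<rho>\<^sub>1 \<and>
         \<sigma> = \<rho>\<^sub>2 \<circ> \<rho>\<^sub>1 \<and> compose B \<rho>\<^sub>1 \<rho>\<^sub>2 \<in> contractive_involutions B)"
    (is "_ \<longleftrightarrow> ?iv")
  proof
    assume r: "normed_trivolution \<sigma>"
    then have triv: "trivolution \<sigma>" and contr: "contractive_on UNIV \<sigma>"
      unfolding normed_trivolution_iff by simp_all
    have "\<exists>\<rho>\<^sub>1. algebra_hom \<rho>\<^sub>1 \<and> range \<rho>\<^sub>1 = B \<and> contractive_on UNIV \<rho>\<^sub>1 \<and>
         \<sigma> = \<rho>\<^sub>2 \<circ> \<rho>\<^sub>1 \<and> compose B \<rho>\<^sub>1 \<rho>\<^sub>2 \<in> contractive_involutions B"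
      if "\<rho>\<^sub>2 \<in> contractive_involutions B" for \<rho>\<^sub>2
    proof -
      have \<rho>\<^sub>2: "\<rho>\<^sub>2 \<in> involutions B" "contractive_on B \<rho>\<^sub>2"
        using that unfolding contr_inv by simp_all
      have "contractive_on UNIV (\<rho>\<^sub>2 \<circ> \<sigma>)"
        using contractive_on_comp[OF contr \<rho>\<^sub>2(2)] unfolding B_def by simp
      moreover from this have "contractive_on B ((\<rho>\<^sub>2 \<circ> \<sigma>) \<circ> \<rho>\<^sub>2)"
        using contractive_on_comp[OF \<rho>\<^sub>2(2)] by blast
      ultimately show ?thesis
        using trivolution_factor[OF triv \<rho>\<^sub>2(1) B_def]
        by (intro exI[of _ "\<rho>\<^sub>2 \<circ> \<sigma>"]) (simp add: contr_inv)
    qed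
    moreover have "subalgebra B"
      using subalgebra_range[OF trivolution_conj_antihom[OF triv]] unfolding B_def .
    ultimately show ?iv
      using restr[OF r] by blast
  next
    assume ?iv
    then obtain \<rho>\<^sub>2 where "\<rho>\<^sub>2 \<in> contractive_involutions B"
      by blast
    with \<open>?iv\<close> obtain \<rho>\<^sub>1
      where \<rho>\<^sub>1: "algebra_hom \<rho>\<^sub>1" "range \<rho>\<^sub>1 = B" "contractive_on UNIV \<rho>\<^sub>1"
      and \<sigma>: "\<sigma> = \<rho>\<^sub>2 \<circ> \<rho>\<^sub>1" and "compose B \<rho>\<^sub>1 \<rho>\<^sub>2 \<in> contractive_involutions B"
      by blast
    with \<open>\<rho>\<^sub>2 \<in> contractive_involutions B\<close>
    have \<rho>\<^sub>2: "\<rho>\<^sub>2 \<in> involutions B" "contractive_on B \<rho>\<^sub>2"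
      and inv: "compose B \<rho>\<^sub>1 \<rho>\<^sub>2 \<in> involutions B"
      unfolding contr_inv by simp_all
    have "trivolution \<sigma>"
      using trivolution_of_factor[OF _ _ \<rho>\<^sub>2(1) \<rho>\<^sub>1(1,2) inv] nz \<sigma> unfolding B_def by simp
    moreover have "contractive_on UNIV \<sigma>"
      using contractive_on_comp[OF \<rho>\<^sub>1(3) \<rho>\<^sub>2(2)] \<rho>\<^sub>1(2) \<sigma> by simp
    ultimately show "normed_trivolution \<sigma>"
      unfolding normed_trivolution_iff by simp
  qed
  show "let B = range \<sigma> in
        (normed_trivolution \<sigma> \<longleftrightarrow>
          conjugate_linear_on UNIV \<sigma> \<and> anti_homomorphism_on UNIV \<sigma> \<and>
          contractive_on UNIV \<sigma> \<and>
          restrict \<sigma> B \<in> contractive_involutions B) \<and>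
        (normed_trivolution \<sigma> \<longleftrightarrow>
          subalgebra B \<and>
          (\<exists>p I \<rho>. projection_onto B p \<and> algebra_hom p \<and> contractive_on UNIV p \<and>
             two_sided_ideal I \<and>
             \<rho> \<in> contractive_involutions B \<and> is_direct_sum I B \<and> \<sigma> = \<rho> \<circ> p)) \<and>
        (normed_trivolution \<sigma> \<longleftrightarrow>
          subalgebra B \<and> contractive_involutions B \<noteq> {} \<and>
          (\<forall>\<rho>\<^sub>2\<in>contractive_involutions B. \<exists>\<rho>\<^sub>1. algebra_hom \<rho>\<^sub>1 \<and> range \<rho>\<^sub>1 = B \<and>
             contractive_on UNIV \<rho>\<^sub>1 \<and>
             \<sigma> = \<rho>\<^sub>2 \<circ> \<rho>\<^sub>1 \<and> compose B \<rho>\<^sub>1 \<rho>\<^sub>2 \<in> contractive_involutions B))"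
    unfolding Let_def B_def[symmetric] by (intro conjI i_ii i_iii i_iv)
qed

end
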